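(* Let $O$ be a unique sink orientation of $Q_n$ and let $f$ be a face of $Q_n$. If there exists some $i\in\dim(f)$ such that the set $E(f)_i$ of all $i$-edges contained in $f$ is an $i$-phase of $O$, then $f$ is a hypervertex of $O$.
   Context: The $n$-cube $Q_n$ is the graph on $\{0,1\}^n$ where two vertices are adjacent iff they differ in exactly one coordinate; an edge whose endpoints differ in coordinate $i$ is an $i$-edge, and $E_i$ is the set of $i$-edges. A face of $Q_n$ is given by a string $f\in\{0,1,*\}^n$ and is the induced subgraph on all $v$ with $v_i=f_i$ or $f_i=*$ for every $i$; $\dim(f)=\{i: f_i=*\}$ is the set of dimensions spanned by $f$. An orientation is a function $O:\{0,1\}^n\to\{0,1\}^n$ (outmap) such that $O(v)_i\ne O(v')_i$ whenever $v,v'$ differ exactly in coordinate $i$; $O(v)_i=1$ means the $i$-edge at $v$ is outgoing from $v$, and $O(v)_i=0$ means it is incoming. $O$ is a unique sink orientation (USO) if every face contains exactly one vertex with no outgoing edges inside the face. Phases: let $O$ be a USO. Two $i$-edges $e,e'\in E_i$ are in direct phase if there exist $v\in e$, $w\in e'$ such that $O(v)_j=O(w)_j$ for all $j\neq i$ with $v_j\ne w_j$. Two $i$-edges are in phase if they are linked by a finite sequence of $i$-edges in which consecutive edges are in direct phase. An $i$-phase is an equivalence class of $E_i$ under this relation. A face $f$ is a hypervertex of $O$ if for all vertices $v,w\in f$ and all $j\in[n]\setminus\dim(f)$ we have $O(v)_j=O(w)_j$. *)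

theory Defs
  imports Main
begin

text \<open>The coordinate set \<open>[n]\<close> is the finite type \<open>'n\<close>, so that \<open>n = CARD('n)\<close>; the bits
  \<open>1\<close> and \<open>0\<close> are \<^const>\<open>True\<close> and \<^const>\<open>False\<close>.\<close>

type_synonym 'n vertex = "'n \<Rightarrow> bool"

type_synonym 'n outmap = "'n vertex \<Rightarrow> 'n vertex"

text \<open>\<^const>\<open>None\<close> encodes the symbol \<open>*\<close>.\<close>

type_synonym 'n face = "'n \<Rightarrow> bool option"

definition differ_exactly :: "'n \<Rightarrow> 'n vertex \<Rightarrow> 'n vertex \<Rightarrow> bool" where
  "differ_exactly i v w \<longleftrightarrow> (\<forall>j. v j \<noteq> w j \<longleftrightarrow> j = i)"

definition edges :: "'n \<Rightarrow> 'n vertex set set" where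
  "edges i = {{v, w} | v w. differ_exactly i v w}"

definition dims :: "'n face \<Rightarrow> 'n set" where
  "dims f = {i. f i = None}"

definition face_vertices :: "'n face \<Rightarrow> 'n vertex set" where
  "face_vertices f = {v. \<forall>i. f i = Some (v i) \<or> f i = None}"

definition face_edges :: "'n face \<Rightarrow> 'n \<Rightarrow> 'n vertex set set" where
  "face_edges f i = {e \<in> edges i. e \<subseteq> face_vertices f}"

definition orientation :: "'n outmap \<Rightarrow> bool" where
  "orientation om \<longleftrightarrow> (\<forall>i v w. differ_exactly i v w \<longrightarrow> om v i \<noteq> om w i)"

text \<open>For a vertex \<open>v\<close> of the face \<open>f\<close>, the \<open>j\<close>-edge at \<open>v\<close> lies inside \<open>f\<close> iff \<open>j \<in> dims f\<close>.\<close>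

definition USO :: "'n outmap \<Rightarrow> bool" where
  "USO om \<longleftrightarrow> orientation om \<and>
     (\<forall>f. \<exists>!v. v \<in> face_vertices f \<and> (\<forall>j\<in>dims f. \<not> om v j))"

definition direct_phase :: "'n outmap \<Rightarrow> 'n \<Rightarrow> 'n vertex set rel" where
  "direct_phase om i = {(e, e') \<in> edges i \<times> edges i.
     \<exists>v\<in>e. \<exists>w\<in>e'. \<forall>j. j \<noteq> i \<and> v j \<noteq> w j \<longrightarrow> om v j = om w j}"

text \<open>The transitive closure suffices: \<^const>\<open>direct_phase\<close> is already reflexive on
  the set of \<open>i\<close>-edges.\<close>

definition in_phase :: "'n outmap \<Rightarrow> 'n \<Rightarrow> 'n vertex set rel" where
  "in_phase om i = (direct_phase om i)\<^sup>+"

lemma equiv_in_phase: "equiv (edges i) (in_phase om i)"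
proof (rule equivI)
  have "direct_phase om i \<subseteq> edges i \<times> edges i"
    by (auto simp: direct_phase_def)
  then show "in_phase om i \<subseteq> edges i \<times> edges i"
    unfolding in_phase_def by (rule trancl_subset_Sigma)
  show "refl_on (edges i) (in_phase om i)"
    unfolding in_phase_def
    by (rule refl_onI, rule r_into_trancl) (auto simp: direct_phase_def edges_def)
  have "sym (direct_phase om i)"
    unfolding direct_phase_def sym_def by clarsimp metis
  then show "sym (in_phase om i)"
    unfolding in_phase_def by (rule sym_trancl)
  show "trans (in_phase om i)"
    unfolding in_phase_def by (rule trans_trancl)
qed

definition phases :: "'n outmap \<Rightarrow> 'n \<Rightarrow> 'n vertex set set set" where
  "phases om i = edges i // in_phase om i"

definition hypervertex :: "'n outmap \<Rightarrow> 'n face \<Rightarrow> bool" where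
  "hypervertex om f \<longleftrightarrow>
     (\<forall>v\<in>face_vertices f. \<forall>w\<in>face_vertices f. \<forall>j\<in>- dims f. om v j = om w j)"

end

theory Submission
  imports Defs
begin

text \<open>The outmap of a USO is a bijection on every face. Suppose that the edges of \<open>v, w \<in> f\<close> are
  in direct phase (witnessed by \<open>v\<close> and \<open>w\<close>), but that \<open>O(v)\<close> and \<open>O(w)\<close> differ in a coordinate
  \<open>j\<close> outside \<open>dim(f)\<close>. Let \<open>F\<close> be the face spanned by \<open>v\<close>, \<open>w\<close> and the direction \<open>i\<close>, and let
  \<open>v'\<close> be the vertex of the translate of \<open>F\<close> along \<open>j\<close> whose outmap agrees with that of \<open>v\<close> in the
  dimensions of \<open>F\<close>. Injectivity on the face containing both translates gives
  \<open>O(v')\<^sub>j \<noteq> O(v)\<^sub>j\<close>, so \<open>O(v')\<^sub>j = O(w)\<^sub>j\<close>, and then the edges of \<open>w\<close> and \<open>v'\<close> are in direct phase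
  although only one of them lies in \<open>f\<close>. Hence \<open>O\<close> is constant outside \<open>dim(f)\<close> along direct
  phases within \<open>f\<close>, and these connect all of \<open>E(f)\<^sub>i\<close>.\<close>

lemma face_vertices_fix_iff:
  assumes "F k = None"
  shows "v \<in> face_vertices (F(k := Some b)) \<longleftrightarrow> v \<in> face_vertices F \<and> v k = b"
  using assms by (auto simp: face_vertices_def)

lemma dims_fix: "dims (F(k := Some b)) = dims F - {k}"
  by (auto simp: dims_def)

text \<open>Reversing all edges of one dimension \<open>k\<close> preserves unique sinks: of the sinks of the two
  halves of a face exactly one has an incoming \<open>k\<close>-edge, so exactly one has an outgoing one.\<close>

lemma USO_ex1_outmap_finite:
  assumes "USO om" and "finite A"
  shows "\<exists>!v. v \<in> face_vertices F \<and> (\<forall>j\<in>dims F. om v j \<longleftrightarrow> j \<in> A)"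
  using assms(2)
proof (induction A arbitrary: F)
  case empty
  then show ?case using assms(1) by (simp add: USO_def)
next
  case (insert k A)
  show ?case
  proof (cases "k \<in> dims F")
    case False
    then have "(\<forall>j\<in>dims F. om v j \<longleftrightarrow> j \<in> insert k A) \<longleftrightarrow> (\<forall>j\<in>dims F. om v j \<longleftrightarrow> j \<in> A)" for v
      by auto
    with insert.IH[of F] show ?thesis by simp
  next
    case True
    then have Fk: "F k = None" by (simp add: dims_def)
    define Q where "Q v \<longleftrightarrow> v \<in> face_vertices F \<and> (\<forall>j\<in>dims F - {k}. om v j \<longleftrightarrow> j \<in> A)" for v
    have half: "\<exists>!v. Q v \<and> v k = b" for b
    proof -
      have "v \<in> face_vertices (F(k := Some b)) \<and>
          (\<forall>j\<in>dims (F(k := Some b)). om v j \<longleftrightarrow> j \<in> A) \<longleftrightarrow> Q v \<and> v k = b" for v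
        unfolding face_vertices_fix_iff[of F, OF Fk] dims_fix Q_def by blast
      with insert.IH[of "F(k := Some b)"] show ?thesis by (simp only:)
    qed
    \<comment> \<open>Since \<open>k \<notin> A\<close>, the induction hypothesis for
      \<open>F\<close> itself demands an incoming \<open>k\<close>-edge.\<close>
    have sink: "\<exists>!v. Q v \<and> \<not> om v k"
    proof -
      have "v \<in> face_vertices F \<and> (\<forall>j\<in>dims F. om v j \<longleftrightarrow> j \<in> A) \<longleftrightarrow> Q v \<and> \<not> om v k" for v
        using True insert.hyps unfolding Q_def by blast
      with insert.IH[of F] show ?thesis by simp
    qed
    have goal: "v \<in> face_vertices F \<and> (\<forall>j\<in>dims F. om v j \<longleftrightarrow> j \<in> insert k A)
        \<longleftrightarrow> Q v \<and> om v k" for v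
      using True unfolding Q_def by blast
    obtain s t where s: "Q s" "s k" and t: "Q t" "\<not> t k"
      using half[of True] half[of False] by auto
    have st: "v = s \<or> v = t" if "Q v" for v
      using half[of True] half[of False] s t that by (cases "v k") auto
    have "s \<noteq> t" using s t by auto
    with sink s(1) t(1) st have "om s k \<noteq> om t k" by metis
    with s(1) t(1) st have "\<exists>!v. Q v \<and> om v k" by metis
    then show ?thesis by (simp only: goal)
  qed
qed

text \<open>Finiteness of \<open>'n\<close> makes every prescribed pattern a finite set of
  dimensions to reverse. Existence and uniqueness give the bijectivity of the outmap on
  faces.\<close>

lemma USO_ex1_outmap:
  fixes om :: "'n::finite outmap"
  assumes "USO om"
  shows "\<exists>!v. v \<in> face_vertices F \<and> (\<forall>j\<in>dims F. om v j = p j)"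
  using USO_ex1_outmap_finite[OF assms, of "{j. p j}" F] by simp

lemma face_vertices_agree:
  assumes "v \<in> face_vertices f" and "w \<in> face_vertices f" and "j \<notin> dims f"
  shows "v j = w j"
proof -
  have "f j = Some (v j)" and "f j = Some (w j)"
    using assms by (auto simp: face_vertices_def dims_def)
  then show ?thesis by simp
qed

definition span_face :: "'n vertex \<Rightarrow> 'n set \<Rightarrow> 'n face" where
  "span_face v D = (\<lambda>m. if m \<in> D then None else Some (v m))"

lemma dims_span_face [simp]: "dims (span_face v D) = D"
  by (auto simp: dims_def span_face_def)

lemma face_vertices_span_face:
  "u \<in> face_vertices (span_face v D) \<longleftrightarrow> (\<forall>m. m \<notin> D \<longrightarrow> u m = v m)"
  by (auto simp: face_vertices_def span_face_def)

definition edge_at :: "'n \<Rightarrow> 'n vertex \<Rightarrow> 'n vertex set" where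
  "edge_at i v = {v, v(i := \<not> v i)}"

lemma vertex_in_edge_at [simp]: "v \<in> edge_at i v"
  by (simp add: edge_at_def)

lemma edge_at_in_edges: "edge_at i v \<in> edges i"
  unfolding edge_at_def edges_def differ_exactly_def
  by (intro CollectI exI[of _ v] exI[of _ "v(i := \<not> v i)"]) auto

lemma edge_at_in_face_edges:
  assumes "i \<in> dims f" and "v \<in> face_vertices f"
  shows "edge_at i v \<in> face_edges f i"
  using assms edge_at_in_edges[of i v]
  by (auto simp: face_edges_def face_vertices_def dims_def edge_at_def)

lemma edges_agree:
  assumes "e \<in> edges i" and "x \<in> e" and "y \<in> e" and "j \<noteq> i"
  shows "x j = y j"
  using assms by (auto simp: edges_def differ_exactly_def)

text \<open>The phase hypothesis enters as closure of the \<open>i\<close>-edges of \<open>f\<close>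
  under direct phase. The vertices \<open>v\<close> and \<open>w\<close> may also be the two ends of
  one \<open>i\<close>-edge.\<close>

lemma outmap_eq_on_phase_closed_face:
  fixes om :: "'n::finite outmap"
  assumes "USO om" and i: "i \<in> dims f" and j: "j \<notin> dims f"
    and closed: "\<And>e e'. \<lbrakk>e \<in> face_edges f i; (e, e') \<in> direct_phase om i\<rbrakk> \<Longrightarrow> e' \<in> face_edges f i"
    and v: "v \<in> face_vertices f" and w: "w \<in> face_vertices f"
    and agree: "\<And>m. \<lbrakk>m \<noteq> i; v m \<noteq> w m\<rbrakk> \<Longrightarrow> om v m = om w m"
  shows "om v j = om w j"
proof (rule ccontr)
  assume neq: "om v j \<noteq> om w j"
  define D where "D = insert i {m. v m \<noteq> w m}"
  have "v j = w j"
    using face_vertices_agree[OF v w j] .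
  then have jD: "j \<notin> D" using i j by (auto simp: D_def)
  obtain v' where v': "v' \<in> face_vertices (span_face (v(j := \<not> v j)) D)"
    and out: "\<forall>m\<in>D. om v' m = om v m"
    using USO_ex1_outmap[OF \<open>USO om\<close>, of "span_face (v(j := \<not> v j)) D" "om v"] by auto
  have v'j: "v' j \<noteq> v j"
    using v' jD by (simp add: face_vertices_span_face)
  have v'eq: "v' m = v m" if "m \<notin> insert j D" for m
    using v' that by (simp add: face_vertices_span_face)
  have "om v' j \<noteq> om v j"
  proof
    assume "om v' j = om v j"
    with out have "\<forall>m\<in>insert j D. om v' m = om v m" by simp
    moreover have "v' \<in> face_vertices (span_face v (insert j D))"
      and "v \<in> face_vertices (span_face v (insert j D))"
      using v'eq by (simp_all add: face_vertices_span_face)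
    ultimately have "v' = v"
      using USO_ex1_outmap[OF \<open>USO om\<close>, of "span_face v (insert j D)" "om v"] by auto
    with v'j show False by simp
  qed
  with neq have "om w j = om v' j" by auto
  have "om w m = om v' m" if "m \<noteq> i" "w m \<noteq> v' m" for m
  proof (cases "m = j")
    case True
    with \<open>om w j = om v' j\<close> show ?thesis by simp
  next
    case False
    \<comment> \<open>If \<open>m\<close> were outside \<open>D\<close>, then \<open>v'\<close>,
      \<open>v\<close> and \<open>w\<close> would all agree at \<open>m\<close>.\<close>
    with that v'eq[of m] have "v m \<noteq> w m" by (auto simp: D_def)
    with out agree that(1) show ?thesis by (auto simp: D_def)
  qed
  then have "(edge_at i w, edge_at i v') \<in> direct_phase om i"
    using edge_at_in_edges[of i w] edge_at_in_edges[of i v'] unfolding direct_phase_def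
    by (intro CollectI case_prodI conjI SigmaI bexI[of _ w] bexI[of _ v']) simp_all
  with closed edge_at_in_face_edges[OF i w] have "edge_at i v' \<in> face_edges f i" .
  then have "v' \<in> face_vertices f"
    using vertex_in_edge_at[of v' i] by (auto simp: face_edges_def)
  with face_vertices_agree[OF _ v j] v'j show False by simp
qed

theorem lemma18:
  fixes om :: "'n::finite outmap" and f :: "'n face"
  assumes "USO om"
    and "\<exists>i\<in>dims f. face_edges f i \<in> phases om i"
  shows "hypervertex om f"
  unfolding hypervertex_def
proof (intro ballI)
  obtain i where i: "i \<in> dims f" and ph: "face_edges f i \<in> edges i // in_phase om i"
    using assms(2) by (auto simp: phases_def)
  have closed': "e' \<in> face_edges f i" if "e \<in> face_edges f i" "(e, e') \<in> in_phase om i" for e e'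
    using in_quotient_imp_closed[OF equiv_in_phase ph that] .
  have closed: "e' \<in> face_edges f i" if "e \<in> face_edges f i" "(e, e') \<in> direct_phase om i" for e e'
    using closed'[of e e'] that by (auto simp: in_phase_def)
  fix v w j
  assume v: "v \<in> face_vertices f" and w: "w \<in> face_vertices f" and "j \<in> - dims f"
  then have j: "j \<notin> dims f" by simp
  note eq = outmap_eq_on_phase_closed_face[OF \<open>USO om\<close> i j closed]
  \<comment> \<open>The ends of an \<open>i\<close>-edge differ only at \<open>i\<close>, so the
    agreement condition holds vacuously.\<close>
  have edge: "om x j = om y j" if "e \<in> face_edges f i" "x \<in> e" "y \<in> e" for e x y
    using that edges_agree[of e i x y] by (intro eq) (auto simp: face_edges_def)
  have direct: "om x j = om y j"
    if e: "e \<in> face_edges f i" and ee': "(e, e') \<in> direct_phase om i" and "x \<in> e" "y \<in> e'"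
    for e e' x y
  proof -
    have e': "e' \<in> face_edges f i" using closed e ee' .
    obtain x' y' where "x' \<in> e" "y' \<in> e'"
      and agree: "\<forall>m. m \<noteq> i \<and> x' m \<noteq> y' m \<longrightarrow> om x' m = om y' m"
      using ee' unfolding direct_phase_def by blast
    have "om x j = om x' j" using edge e \<open>x \<in> e\<close> \<open>x' \<in> e\<close> .
    also have "\<dots> = om y' j"
      using e e' \<open>x' \<in> e\<close> \<open>y' \<in> e'\<close> agree by (intro eq) (auto simp: face_edges_def)
    also have "\<dots> = om y j" using edge e' \<open>y' \<in> e'\<close> \<open>y \<in> e'\<close> .
    finally show ?thesis .
  qed
  have ev: "edge_at i v \<in> face_edges f i" and ew: "edge_at i w \<in> face_edges f i"
    using edge_at_in_face_edges[OF i] v w by simp_all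
  have "(edge_at i v, edge_at i w) \<in> (direct_phase om i)\<^sup>+"
    using in_quotient_imp_in_rel[OF equiv_in_phase ph, of "edge_at i v" "edge_at i w"] ev ew
    by (simp add: in_phase_def)
  \<comment> \<open>Quantifying over both ends of the last edge makes the induction independent of
    which ends witness each direct phase.\<close>
  then have "\<forall>y\<in>edge_at i w. om v j = om y j"
  proof (induction rule: trancl_induct)
    case (base e)
    then show ?case using direct[OF ev _ vertex_in_edge_at] by simp
  next
    case (step e e')
    \<comment> \<open>Closure keeps every edge of the chain inside \<open>f\<close>, where
      \<open>direct\<close> applies.\<close>
    have e: "e \<in> face_edges f i"
      using closed' ev step.hyps(1) by (simp add: in_phase_def)
    then have "e \<noteq> {}" by (auto simp: face_edges_def edges_def)
    then obtain x where "x \<in> e" by blast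
    with step.IH have "om v j = om x j" by simp
    with direct[OF e step.hyps(2) \<open>x \<in> e\<close>] show ?case by simp
  qed
  then show "om v j = om w j" by simp
qed

end
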